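(* Let $\Sigma$ be a ternary alphabet and $w,w'\in\Sigma^*$. Then $w'$ is obtained from $w$ by an irreducible strong $(2\cdot 2)$ transformation if and only if there exist a naming $\Sigma=\{a,b,c\}$ of the three letters and words $w_1,w_2,w_3,w_4,w_5\in\Sigma^*$ such that $$w=w_1\,ab\,w_2\,ba\,w_3\,ba\,w_4\,ab\,w_5,\qquad w'=w_1\,ba\,w_2\,ab\,w_3\,ab\,w_4\,ba\,w_5,$$ and $|w_2|_c=|w_4|_c>0$.
   Context: $\Sigma^*$ is the set of all finite words over $\Sigma$; $|w|_c$ is the number of occurrences of the letter $c$ in $w$. A factor of $w$ is a contiguous subword. Strong $(2\cdot t)$ transformation ($t\ge1$): $w'$ is obtained from $w$ by a strong $(2\cdot t)$ transformation if, for some naming $\{a,b,c\}$ of the three letters of $\Sigma$ and some integer $0\le t'\le t$, $w$ contains $t$ specified occurrences of factors $\beta_1,\dots,\beta_t$ with $\beta_k=ab\,x_k\,ba$ for $1\le k\le t'$ and $\beta_k=ba\,x_k\,ab$ for $t'+1\le k\le t$, where (1) $x_k\in\Sigma^*$; (2) the first two and last two letters of $\beta_m$ do not overlap, as positions in $w$, with the first two and last two letters of $\beta_n$ whenever $m\neq n$; (3) $\sum_{k=1}^{t'}|x_k|_c=\sum_{k=t'+1}^{t}|x_k|_c$; and $w'$ is obtained from $w$ by simultaneously swapping the two letters in each of these $2t$ pairs (i.e. $ab\,x_k\,ba$ becomes $ba\,x_k\,ab$ and vice versa). The factors themselves may be nested or overlap. A strong $(2\cdot t)$ transformation of $w$ into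 $w'$ is reducible if there exist $w''\in\Sigma^*$ and integers $t_1,t_2>0$ with $t_1+t_2=t$ such that $w''$ is obtained from $w$ by a strong $(2\cdot t_1)$ transformation and $w'$ is obtained from $w''$ by a strong $(2\cdot t_2)$ transformation. Otherwise it is irreducible. *)

theory Defs
  imports Main
begin

text \<open>Words over an alphabet \<open>\<Sigma>\<close> are the elements of \<^term>\<open>lists \<Sigma>\<close>; \<open>|w|\<^sub>c\<close> is
  \<^term>\<open>count_list w c\<close>. Positions in a word are counted from 0.\<close>

definition naming :: "'a set \<Rightarrow> 'a \<Rightarrow> 'a \<Rightarrow> 'a \<Rightarrow> bool" where
  "naming \<Sigma> a b c \<longleftrightarrow> distinct [a, b, c] \<and> \<Sigma> = {a, b, c}"

definition factor_at :: "'a list \<Rightarrow> nat \<Rightarrow> 'a list \<Rightarrow> bool" where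
  "factor_at w i f \<longleftrightarrow> (\<exists>u v. w = u @ f @ v \<and> length u = i)"

text \<open>For a factor \<open>de x ed\<close> occurring at position \<open>i\<close>, the start positions of its first and of
  its last pair of letters, and the four positions that these two pairs occupy.\<close>

definition pair_starts :: "nat \<Rightarrow> 'a list \<Rightarrow> nat set" where
  "pair_starts i x = {i, i + 2 + length x}"

definition pair_positions :: "nat \<Rightarrow> 'a list \<Rightarrow> nat set" where
  "pair_positions i x = pair_starts i x \<union> Suc ` pair_starts i x"

text \<open>Simultaneously swap the letters at positions \<open>i\<close> and \<open>i + 1\<close> for all \<open>i \<in> S\<close>. This is
  meant for \<open>S\<close> such that these pairs of positions lie within the word and are pairwise disjoint,
  which is always the case in \<open>strong_transformation\<close> below.\<close>

definition swap_pairs :: "nat set \<Rightarrow> 'a list \<Rightarrow> 'a list" where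
  "swap_pairs S w =
     map (\<lambda>i. if i \<in> S then w ! Suc i else if i \<in> Suc ` S then w ! (i - 1) else w ! i)
       [0..<length w]"

text \<open>\<open>strong_transformation \<Sigma> t w w'\<close>: the word \<open>w'\<close> is obtained from \<open>w\<close> by a strong
  \<open>(2\<cdot>t)\<close> transformation. The \<open>k\<close>-th specified occurrence starts at position \<open>p k\<close>.\<close>

definition strong_transformation :: "'a set \<Rightarrow> nat \<Rightarrow> 'a list \<Rightarrow> 'a list \<Rightarrow> bool" where
  "strong_transformation \<Sigma> t w w' \<longleftrightarrow>
     t \<ge> 1 \<and>
     (\<exists>a b c t' (p :: nat \<Rightarrow> nat) (x :: nat \<Rightarrow> 'a list).
        naming \<Sigma> a b c \<and> t' \<le> t \<and>
        (\<forall>k\<in>{1..t}. x k \<in> lists \<Sigma>) \<and>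
        (\<forall>k\<in>{1..t'}. factor_at w (p k) ([a, b] @ x k @ [b, a])) \<and>
        (\<forall>k\<in>{t'+1..t}. factor_at w (p k) ([b, a] @ x k @ [a, b])) \<and>
        (\<forall>m\<in>{1..t}. \<forall>n\<in>{1..t}. m \<noteq> n \<longrightarrow>
           pair_positions (p m) (x m) \<inter> pair_positions (p n) (x n) = {}) \<and>
        (\<Sum>k\<in>{1..t'}. count_list (x k) c) = (\<Sum>k\<in>{t'+1..t}. count_list (x k) c) \<and>
        w' = swap_pairs (\<Union>k\<in>{1..t}. pair_starts (p k) (x k)) w)"

text \<open>Reducibility depends only on \<open>t\<close>, \<open>w\<close> and \<open>w'\<close>, not on the occurrences chosen to
  transform \<open>w\<close> into \<open>w'\<close>; the two intermediate steps may use different namings.\<close>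

definition reducible_transformation :: "'a set \<Rightarrow> nat \<Rightarrow> 'a list \<Rightarrow> 'a list \<Rightarrow> bool" where
  "reducible_transformation \<Sigma> t w w' \<longleftrightarrow>
     (\<exists>w''\<in>lists \<Sigma>. \<exists>t1 t2. t1 > 0 \<and> t2 > 0 \<and> t1 + t2 = t \<and>
        strong_transformation \<Sigma> t1 w w'' \<and> strong_transformation \<Sigma> t2 w'' w')"

definition irreducible_strong_transformation :: "'a set \<Rightarrow> nat \<Rightarrow> 'a list \<Rightarrow> 'a list \<Rightarrow> bool" where
  "irreducible_strong_transformation \<Sigma> t w w' \<longleftrightarrow>
     strong_transformation \<Sigma> t w w' \<and> \<not> reducible_transformation \<Sigma> t w w'"

end

theory Submission
  imports Defs
begin

text \<open>A strong \<open>(2\<cdot>1)\<close> transformation is a very local move: the condition on the number of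
  \<open>c\<close> then says that \<open>c\<close> does not occur in \<open>x\<close>, so that it replaces a \<open>c\<close>-free factor
  \<open>ab x ba\<close> by \<open>ba x ab\<close> (\<open>strong_transformation_1_iff\<close>). A strong \<open>(2\<cdot>2)\<close> transformation is
  reducible if and only if two such moves lead from \<open>w\<close> to \<open>w'\<close>.

  Given two specified occurrences, sort their four pairs by position. The occurrences are disjoint,
  interleaved or nested (\<open>two_factors_cases\<close>). If both are of the same kind, condition (3) makes
  both \<open>c\<close>-free and they can be transformed one after the other. If they are of opposite kind, the
  word reads \<open>ab w2 ba w3 ba w4 ab\<close> or \<open>ab w2 ba w3 ab w4 ba\<close>, up to exchanging \<open>a\<close> and \<open>b\<close>. After
  cancelling the \<open>c\<close> that both factors share, condition (3) says \<open>|w2|\<^sub>c = |w4|\<^sub>c\<close>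
  in the first case and \<open>|w2|\<^sub>c = |w4|\<^sub>c = 0\<close> in the second. Whenever these numbers are \<open>0\<close>, the
  first two and the last two pairs can be swapped by two separate moves. What remains is the
  stated form.

  Conversely, in the stated form two local moves cannot suffice. A move that permutes the letters
  \<open>d\<close> and \<open>e\<close> changes the projection of the word to \<open>{d, e}\<close> but not the other two projections
  to two letters. Comparing projections, both moves must permute \<open>a\<close> and \<open>b\<close>. Such moves fix the
  positions of all \<open>c\<close>, and each acts inside one \<open>c\<close>-free block, where it preserves the number
  \<open>|\<cdot>|\<^bsub>ab\<^esub>\<close> of scattered subwords \<open>ab\<close>. Hence this number is preserved for the
  prefix ending just before the first \<open>c\<close> of \<open>w2\<close> (\<open>local_move_prefix\<close>). But this prefix
  contains exactly one of the four swapped pairs, so the number drops by one.\<close>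


section \<open>Swapping pairs of letters\<close>

lemma swap_pairs_empty [simp]: "swap_pairs {} w = w"
  by (rule nth_equalityI) (auto simp: swap_pairs_def)

text \<open>Disjoint pairs do not interact, so they can be swapped one at a time. This computes
  \<open>swap_pairs\<close> on words whose pairs are written out.\<close>

lemma swap_pairs_insert:
  assumes "n = length u" "n \<notin> S" "Suc n \<notin> S" "n \<notin> Suc ` S"
  shows "swap_pairs (insert n S) (u @ d # e # v) = swap_pairs S (u @ e # d # v)"
proof (rule nth_equalityI)
  show "length (swap_pairs (insert n S) (u @ d # e # v)) = length (swap_pairs S (u @ e # d # v))"
    by (simp add: swap_pairs_def)
next
  fix i assume "i < length (swap_pairs (insert n S) (u @ d # e # v))"
  then have i: "i < length u + 2 + length v"
    by (simp add: swap_pairs_def)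
  have away: "(u @ d # e # v) ! j = (u @ e # d # v) ! j" if "j \<noteq> n" "j \<noteq> Suc n" for j
    using that assms(1) by (cases "j < n") (auto simp: nth_append nth_Cons split: nat.split)
  have at: "(u @ d # e # v) ! n = d" "(u @ d # e # v) ! Suc n = e"
    "(u @ e # d # v) ! n = e" "(u @ e # d # v) ! Suc n = d"
    using assms(1) by (auto simp: nth_append)
  consider "i = n" | "i = Suc n" | "i \<noteq> n" "i \<noteq> Suc n" by blast
  then show "swap_pairs (insert n S) (u @ d # e # v) ! i = swap_pairs S (u @ e # d # v) ! i"
  proof cases
    case 1
    then show ?thesis using assms i at by (auto simp: swap_pairs_def simp del: upt_Suc)
  next
    case 2
    then show ?thesis using assms i at by (auto simp: swap_pairs_def simp del: upt_Suc)
  next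
    case 3
    have "Suc i \<noteq> n" "Suc i \<noteq> Suc n" if "i \<in> S"
      using that imageI[OF that, of Suc] assms(2-4) 3(1) by (metis nat.inject)+
    moreover have "i - 1 \<noteq> n" "i - 1 \<noteq> Suc n" if "i \<in> Suc ` S" using that assms 3 by auto
    ultimately show ?thesis
      using 3 i away by (auto simp: swap_pairs_def simp del: upt_Suc)
  qed
qed

lemma swap_two_pairs:
  "swap_pairs {length u, length u + 2 + length x} (u @ [d, e] @ x @ [f, g] @ v)
     = u @ [e, d] @ x @ [g, f] @ v"
  using swap_pairs_insert[of "length u" u "{length u + 2 + length x}" d e "x @ [f, g] @ v"]
    swap_pairs_insert[of "length u + 2 + length x" "u @ [e, d] @ x" "{}" f g v]
  by simp

lemma swap_four_pairs:
  assumes "i = length u" "j = i + 2 + length x" "k = j + 2 + length y" "l = k + 2 + length z"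
  shows "swap_pairs {i, j, k, l} (u @ [d, e] @ x @ [f, g] @ y @ [h, m] @ z @ [n, q] @ v)
     = u @ [e, d] @ x @ [g, f] @ y @ [m, h] @ z @ [q, n] @ v"
  using assms
    swap_pairs_insert[of i u "{j, k, l}" d e "x @ [f, g] @ y @ [h, m] @ z @ [n, q] @ v"]
    swap_pairs_insert[of j "u @ [e, d] @ x" "{k, l}" f g "y @ [h, m] @ z @ [n, q] @ v"]
    swap_two_pairs[of "u @ [e, d] @ x @ [g, f] @ y" z h m n q v]
  by (simp add: add.assoc)


section \<open>Sorting the pairs of two occurrences\<close>

lemma factor_at_drop:
  assumes "factor_at w j g" "i \<le> j"
  shows "factor_at (drop i w) (j - i) g"
proof -
  obtain u v where "w = u @ g @ v" "length u = j"
    using assms(1) by (auto simp: factor_at_def)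
  then have "drop i w = drop i u @ g @ v" "length (drop i u) = j - i"
    using assms(2) by auto
  then show ?thesis unfolding factor_at_def by blast
qed

lemma factor_at_parts:
  assumes "factor_at w i (f @ x @ g)"
  shows "factor_at w i f" "factor_at w (i + length f) x"
    "factor_at w (i + length f + length x) g"
proof -
  obtain u v where w: "w = u @ f @ x @ g @ v" "length u = i"
    using assms by (auto simp: factor_at_def)
  then show "factor_at w i f" by (auto simp: factor_at_def)
  have "w = (u @ f) @ x @ (g @ v)" "length (u @ f) = i + length f" using w by simp_all
  then show "factor_at w (i + length f) x" unfolding factor_at_def by blast
  have "w = (u @ f @ x) @ g @ v" "length (u @ f @ x) = i + length f + length x"
    using w by simp_all
  then show "factor_at w (i + length f + length x) g" unfolding factor_at_def by blast
qed

lemma factor_at_split: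
  assumes "factor_at w i f" "length f = n"
  obtains u where "w = u @ f @ drop (i + n) w" "length u = i"
  using assms by (auto simp: factor_at_def)

lemma four_pairs_split:
  assumes "factor_at w i f" "factor_at w j g" "factor_at w k h" "factor_at w l m"
    and "length f = 2" "length g = 2" "length h = 2" "length m = 2"
    and "i + 2 \<le> j" "j + 2 \<le> k" "k + 2 \<le> l"
  obtains w1 w2 w3 w4 w5 where
    "w = w1 @ f @ w2 @ g @ w3 @ h @ w4 @ m @ w5"
    "i = length w1" "j = i + 2 + length w2" "k = j + 2 + length w3" "l = k + 2 + length w4"
proof -
  obtain w1 where 1: "w = w1 @ f @ drop (i + 2) w" "length w1 = i"
    by (rule factor_at_split[OF assms(1,5)])
  obtain w2 where 2: "drop (i + 2) w = w2 @ g @ drop (j - (i + 2) + 2) (drop (i + 2) w)"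
    "length w2 = j - (i + 2)"
    by (rule factor_at_split[OF factor_at_drop[OF assms(2,9)] assms(6)])
  obtain w3 where 3: "drop (j + 2) w = w3 @ h @ drop (k - (j + 2) + 2) (drop (j + 2) w)"
    "length w3 = k - (j + 2)"
    by (rule factor_at_split[OF factor_at_drop[OF assms(3,10)] assms(7)])
  obtain w4 where 4: "drop (k + 2) w = w4 @ m @ drop (l - (k + 2) + 2) (drop (k + 2) w)"
    "length w4 = l - (k + 2)"
    by (rule factor_at_split[OF factor_at_drop[OF assms(4,11)] assms(8)])
  have "j - (i + 2) + 2 + (i + 2) = j + 2" "k - (j + 2) + 2 + (j + 2) = k + 2"
    using assms(9,10) by simp_all
  then have "drop (i + 2) w = w2 @ g @ drop (j + 2) w" "drop (j + 2) w = w3 @ h @ drop (k + 2) w"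
    using 2(1) 3(1) by (simp_all only: drop_drop)
  moreover define w5 where "w5 = drop (l - (k + 2) + 2) (drop (k + 2) w)"
  then have "drop (k + 2) w = w4 @ m @ w5"
    using 4(1) by (simp only:)
  ultimately have "w1 @ f @ drop (i + 2) w = w1 @ f @ w2 @ g @ w3 @ h @ w4 @ m @ w5"
    by (simp only:)
  with 1(1) have "w = w1 @ f @ w2 @ g @ w3 @ h @ w4 @ m @ w5" by (rule trans)
  then show thesis
    using that 1(2) 2(2) 3(2) 4(2) assms(9-11) by simp
qed

lemma factor_at_unique:
  assumes "factor_at (u @ f @ v) (length u) g" "length f = length g"
  shows "f = g"
  using assms by (auto simp: factor_at_def)

text \<open>The start positions of the four pairs differ pairwise by at least \<open>2\<close>, so they can be sorted.
  As \<open>i < j\<close>, only the place of the last pair of the first factor is open: it comes second, third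
  or last. These are the cases of disjoint, interleaved and nested occurrences.\<close>

lemma two_factors_cases:
  assumes x: "factor_at w i ([d, e] @ x @ [e, d])" and y: "factor_at w j ([f, g] @ y @ [g, f])"
    and "i < j" and dis: "pair_positions i x \<inter> pair_positions j y = {}"
    and w': "w' = swap_pairs (pair_starts i x \<union> pair_starts j y) w"
  obtains
    w1 w2 w3 w4 w5 where "x = w2" "y = w4"
      "w = w1 @ [d, e] @ w2 @ [e, d] @ w3 @ [f, g] @ w4 @ [g, f] @ w5"
      "w' = w1 @ [e, d] @ w2 @ [d, e] @ w3 @ [g, f] @ w4 @ [f, g] @ w5"
  | w1 w2 w3 w4 w5 where "x = w2 @ [f, g] @ w3" "y = w3 @ [e, d] @ w4"
      "w = w1 @ [d, e] @ w2 @ [f, g] @ w3 @ [e, d] @ w4 @ [g, f] @ w5"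
      "w' = w1 @ [e, d] @ w2 @ [g, f] @ w3 @ [d, e] @ w4 @ [f, g] @ w5"
  | w1 w2 w3 w4 w5 where "x = w2 @ [f, g] @ w3 @ [g, f] @ w4" "y = w3"
      "w = w1 @ [d, e] @ w2 @ [f, g] @ w3 @ [g, f] @ w4 @ [e, d] @ w5"
      "w' = w1 @ [e, d] @ w2 @ [g, f] @ w3 @ [f, g] @ w4 @ [d, e] @ w5"
proof -
  define k l where "k = i + 2 + length x" and "l = j + 2 + length y"
  have fs: "factor_at w i [d, e]" "factor_at w (i + 2) x" "factor_at w k [e, d]"
    "factor_at w j [f, g]" "factor_at w (j + 2) y" "factor_at w l [g, f]"
    using factor_at_parts[OF x] factor_at_parts[OF y] by (simp_all add: k_def l_def)
  have "pair_positions i x = {i, k, Suc i, Suc k}" "pair_positions j y = {j, l, Suc j, Suc l}"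
    by (auto simp: pair_positions_def pair_starts_def k_def l_def)
  with dis have ne: "Suc i \<noteq> j" "k \<noteq> j" "Suc k \<noteq> j" "k \<noteq> Suc j" "k \<noteq> l" "Suc k \<noteq> l" "k \<noteq> Suc l"
    by auto
  have starts: "pair_starts i x \<union> pair_starts j y = {i, k, j, l}"
    by (auto simp: pair_starts_def k_def l_def)
  have gaps: "i + 2 \<le> j" "i + 2 \<le> k" "j + 2 \<le> l"
    using ne \<open>i < j\<close> by (auto simp: k_def l_def)
  consider (disjoint) "k + 2 \<le> j" | (interleaved) "j + 2 \<le> k" "k + 2 \<le> l" | (nested) "l + 2 \<le> k"
    using ne by linarith
  then show thesis
  proof cases
    case disjoint
    obtain w1 w2 w3 w4 w5 where dec:
      "w = w1 @ [d, e] @ w2 @ [e, d] @ w3 @ [f, g] @ w4 @ [g, f] @ w5"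
      "i = length w1" "k = i + 2 + length w2" "j = k + 2 + length w3" "l = j + 2 + length w4"
      by (rule four_pairs_split[OF fs(1,3,4,6)]) (use gaps disjoint in auto)
    have "w2 = x"
      by (rule factor_at_unique[of "w1 @ [d, e]" _ "[e, d] @ w3 @ [f, g] @ w4 @ [g, f] @ w5"])
        (use fs dec k_def in auto)
    moreover have "w4 = y"
      by (rule factor_at_unique[of "w1 @ [d, e] @ w2 @ [e, d] @ w3 @ [f, g]" _ "[g, f] @ w5"])
        (use fs dec l_def in \<open>auto simp: add.commute add.left_commute\<close>)
    moreover have "w' = w1 @ [e, d] @ w2 @ [d, e] @ w3 @ [g, f] @ w4 @ [f, g] @ w5"
      unfolding w' starts dec(1) by (rule swap_four_pairs) (fact dec)+
    ultimately show thesis using that(1) dec(1) by blast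
  next
    case interleaved
    obtain w1 w2 w3 w4 w5 where dec:
      "w = w1 @ [d, e] @ w2 @ [f, g] @ w3 @ [e, d] @ w4 @ [g, f] @ w5"
      "i = length w1" "j = i + 2 + length w2" "k = j + 2 + length w3" "l = k + 2 + length w4"
      by (rule four_pairs_split[OF fs(1,4,3,6)]) (use gaps interleaved in auto)
    have "w2 @ [f, g] @ w3 = x"
      by (rule factor_at_unique[of "w1 @ [d, e]" _ "[e, d] @ w4 @ [g, f] @ w5"])
        (use fs dec k_def in auto)
    moreover have "w3 @ [e, d] @ w4 = y"
      by (rule factor_at_unique[of "w1 @ [d, e] @ w2 @ [f, g]" _ "[g, f] @ w5"])
        (use fs dec l_def in \<open>auto simp: add.commute add.left_commute\<close>)
    moreover have perm: "{i, k, j, l} = {i, j, k, l}" by auto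
    have "w' = w1 @ [e, d] @ w2 @ [g, f] @ w3 @ [d, e] @ w4 @ [f, g] @ w5"
      unfolding w' starts perm dec(1) by (rule swap_four_pairs) (fact dec)+
    ultimately show thesis using that(2) dec(1) by blast
  next
    case nested
    obtain w1 w2 w3 w4 w5 where dec:
      "w = w1 @ [d, e] @ w2 @ [f, g] @ w3 @ [g, f] @ w4 @ [e, d] @ w5"
      "i = length w1" "j = i + 2 + length w2" "l = j + 2 + length w3" "k = l + 2 + length w4"
      by (rule four_pairs_split[OF fs(1,4,6,3)]) (use gaps nested in auto)
    have "w2 @ [f, g] @ w3 @ [g, f] @ w4 = x"
      by (rule factor_at_unique[of "w1 @ [d, e]" _ "[e, d] @ w5"])
        (use fs dec k_def in auto)
    moreover have "w3 = y"
      by (rule factor_at_unique[of "w1 @ [d, e] @ w2 @ [f, g]" _ "[g, f] @ w4 @ [e, d] @ w5"])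
        (use fs dec l_def in \<open>auto simp: add.commute add.left_commute\<close>)
    moreover have perm: "{i, k, j, l} = {i, j, l, k}" by auto
    have "w' = w1 @ [e, d] @ w2 @ [g, f] @ w3 @ [f, g] @ w4 @ [d, e] @ w5"
      unfolding w' starts perm dec(1) by (rule swap_four_pairs) (fact dec)+
    ultimately show thesis using that(3) dec(1) by blast
  qed
qed


section \<open>Local moves\<close>

text \<open>The parameter \<open>c\<close> is the letter that does not take part in the move. It is kept explicit
  because it determines which invariants the move has.\<close>

definition local_move :: "'a set \<Rightarrow> 'a \<Rightarrow> 'a list \<Rightarrow> 'a list \<Rightarrow> bool" where
  "local_move \<Sigma> c w w' \<longleftrightarrow> (\<exists>a b u x v. naming \<Sigma> a b c \<and> c \<notin> set x \<and>
     w = u @ [a, b] @ x @ [b, a] @ v \<and> w' = u @ [b, a] @ x @ [a, b] @ v)"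

lemma naming_swap: "naming \<Sigma> a b c \<Longrightarrow> naming \<Sigma> b a c"
  by (auto simp: naming_def)

lemma local_moveI:
  "\<lbrakk>naming \<Sigma> a b c; c \<notin> set x\<rbrakk> \<Longrightarrow>
     local_move \<Sigma> c (u @ [a, b] @ x @ [b, a] @ v) (u @ [b, a] @ x @ [a, b] @ v)"
  unfolding local_move_def by blast

lemma local_move_in_lists:
  assumes "local_move \<Sigma> c w w'" "w \<in> lists \<Sigma>"
  shows "w' \<in> lists \<Sigma>"
  using assms by (auto simp: local_move_def)

lemma strong_transformation_1_iff:
  assumes "w \<in> lists \<Sigma>"
  shows "strong_transformation \<Sigma> 1 w w' \<longleftrightarrow> (\<exists>c. local_move \<Sigma> c w w')"
proof
  assume "strong_transformation \<Sigma> 1 w w'"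
  then obtain a b c t' p x where nam: "naming \<Sigma> a b c" and t': "t' \<le> (1::nat)"
    and f1: "\<forall>k\<in>{1..t'}. factor_at w (p k) ([a, b] @ x k @ [b, a])"
    and f2: "\<forall>k\<in>{t'+1..1}. factor_at w (p k) ([b, a] @ x k @ [a, b])"
    and sums: "(\<Sum>k\<in>{1..t'}. count_list (x k) c) = (\<Sum>k\<in>{t'+1..1}. count_list (x k) c)"
    and w': "w' = swap_pairs (\<Union>k\<in>{1..1}. pair_starts (p k) (x k)) w"
    unfolding strong_transformation_def by blast
  have "t' = 0 \<or> t' = 1" using t' by linarith
  then have "count_list (x 1) c = 0" using sums by auto
  then have c: "c \<notin> set (x 1)" by (simp add: count_list_0_iff)
  from \<open>t' = 0 \<or> t' = 1\<close> obtain d e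
    where de: "naming \<Sigma> d e c" "factor_at w (p 1) ([d, e] @ x 1 @ [e, d])"
  proof
    assume "t' = 0"
    then show ?thesis using that[of b a] f2 naming_swap[OF nam] by simp
  next
    assume "t' = 1"
    then show ?thesis using that[of a b] f1 nam by simp
  qed
  then obtain u v where uv: "w = u @ [d, e] @ x 1 @ [e, d] @ v" "length u = p 1"
    by (auto simp: factor_at_def)
  then have "w' = u @ [e, d] @ x 1 @ [d, e] @ v"
    using w' swap_two_pairs[of u "x 1" d e e d v] by (simp add: pair_starts_def)
  with uv(1) local_moveI[OF de(1) c, of u v] show "\<exists>c. local_move \<Sigma> c w w'" by auto
next
  assume "\<exists>c. local_move \<Sigma> c w w'"
  then obtain a b c u x v where m: "naming \<Sigma> a b c" "c \<notin> set x"
    "w = u @ [a, b] @ x @ [b, a] @ v" "w' = u @ [b, a] @ x @ [a, b] @ v"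
    unfolding local_move_def by blast
  have "factor_at w (length u) ([a, b] @ x @ [b, a])"
    using m(3) by (auto simp: factor_at_def)
  moreover have "w' = swap_pairs (pair_starts (length u) x) w"
    unfolding m(3,4) pair_starts_def by (rule swap_two_pairs[symmetric])
  moreover have "x \<in> lists \<Sigma>" using assms m(3) by auto
  ultimately show "strong_transformation \<Sigma> 1 w w'"
    unfolding strong_transformation_def using m(1,2)
    by (intro conjI exI[of _ a] exI[of _ b] exI[of _ c] exI[of _ 1]
        exI[of _ "\<lambda>_. length u"] exI[of _ "\<lambda>_. x"]) (auto simp: count_list_0_iff)
qed

lemma reducible_2_iff:
  assumes "w \<in> lists \<Sigma>"
  shows "reducible_transformation \<Sigma> 2 w w' \<longleftrightarrow>
    (\<exists>w'' c1 c2. local_move \<Sigma> c1 w w'' \<and> local_move \<Sigma> c2 w'' w')"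
proof -
  have split: "t1 > 0 \<and> t2 > 0 \<and> t1 + t2 = 2 \<longleftrightarrow> t1 = 1 \<and> t2 = 1" for t1 t2 :: nat
    by auto
  have "reducible_transformation \<Sigma> 2 w w' \<longleftrightarrow>
    (\<exists>w''\<in>lists \<Sigma>. strong_transformation \<Sigma> 1 w w'' \<and> strong_transformation \<Sigma> 1 w'' w')"
    unfolding reducible_transformation_def using split by metis
  also have "\<dots> \<longleftrightarrow> (\<exists>w'' c1 c2. local_move \<Sigma> c1 w w'' \<and> local_move \<Sigma> c2 w'' w')"
    using strong_transformation_1_iff assms local_move_in_lists by metis
  finally show ?thesis .
qed


section \<open>Irreducible transformations have the stated form\<close>

text \<open>Two factors of opposite kind that do not overlap. The case \<open>|w4|\<^sub>c = 0\<close> is included, because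
  both it and the form in the theorem arise from the same arrangements of the pairs.\<close>

definition opposed_pairs ::
    "'a \<Rightarrow> 'a \<Rightarrow> 'a \<Rightarrow> 'a list \<Rightarrow> 'a list \<Rightarrow> 'a list \<Rightarrow> 'a list \<Rightarrow> 'a list \<Rightarrow> 'a list \<Rightarrow> 'a list \<Rightarrow> bool" where
  "opposed_pairs a b c w w' w1 w2 w3 w4 w5 \<longleftrightarrow>
     w = w1 @ [a, b] @ w2 @ [b, a] @ w3 @ [b, a] @ w4 @ [a, b] @ w5 \<and>
     w' = w1 @ [b, a] @ w2 @ [a, b] @ w3 @ [a, b] @ w4 @ [b, a] @ w5 \<and>
     count_list w2 c = count_list w4 c"

text \<open>The next three lemmas are the three ways to match up four pairs in a row: \<open>12\<close> with \<open>34\<close>,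
  \<open>13\<close> with \<open>24\<close>, and \<open>14\<close> with \<open>23\<close>. The first move may swap letters inside the factor of the
  second one or the other way round, but this exchanges no \<open>c\<close>, so both factors stay \<open>c\<close>-free.\<close>

lemma two_moves_disjoint:
  assumes "naming \<Sigma> d e c" "naming \<Sigma> f g c" "c \<notin> set w2" "c \<notin> set w4"
  shows "\<exists>w''. local_move \<Sigma> c (w1 @ [d, e] @ w2 @ [e, d] @ w3 @ [f, g] @ w4 @ [g, f] @ w5) w'' \<and>
    local_move \<Sigma> c w'' (w1 @ [e, d] @ w2 @ [d, e] @ w3 @ [g, f] @ w4 @ [f, g] @ w5)"
  using local_moveI[OF assms(1,3), of w1 "w3 @ [f, g] @ w4 @ [g, f] @ w5"]
    local_moveI[OF assms(2,4), of "w1 @ [e, d] @ w2 @ [d, e] @ w3" w5]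
  by (auto intro!: exI[of _ "w1 @ [e, d] @ w2 @ [d, e] @ w3 @ [f, g] @ w4 @ [g, f] @ w5"])

lemma two_moves_interleaved:
  assumes "naming \<Sigma> d e c" "naming \<Sigma> f g c" "c \<notin> set w2" "c \<notin> set w3" "c \<notin> set w4"
  shows "\<exists>w''. local_move \<Sigma> c (w1 @ [d, e] @ w2 @ [f, g] @ w3 @ [e, d] @ w4 @ [g, f] @ w5) w'' \<and>
    local_move \<Sigma> c w'' (w1 @ [e, d] @ w2 @ [g, f] @ w3 @ [d, e] @ w4 @ [f, g] @ w5)"
proof -
  have "c \<notin> set (w2 @ [f, g] @ w3)" "c \<notin> set (w3 @ [d, e] @ w4)"
    using assms by (auto simp: naming_def)
  from local_moveI[OF assms(1) this(1), of w1 "w4 @ [g, f] @ w5"]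
    local_moveI[OF assms(2) this(2), of "w1 @ [e, d] @ w2" w5]
  show ?thesis
    by (auto intro!: exI[of _ "w1 @ [e, d] @ w2 @ [f, g] @ w3 @ [d, e] @ w4 @ [g, f] @ w5"])
qed

lemma two_moves_nested:
  assumes "naming \<Sigma> d e c" "naming \<Sigma> f g c" "c \<notin> set w2" "c \<notin> set w3" "c \<notin> set w4"
  shows "\<exists>w''. local_move \<Sigma> c (w1 @ [d, e] @ w2 @ [f, g] @ w3 @ [g, f] @ w4 @ [e, d] @ w5) w'' \<and>
    local_move \<Sigma> c w'' (w1 @ [e, d] @ w2 @ [g, f] @ w3 @ [f, g] @ w4 @ [d, e] @ w5)"
proof -
  have "c \<notin> set (w2 @ [f, g] @ w3 @ [g, f] @ w4)"
    using assms by (auto simp: naming_def)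
  from local_moveI[OF assms(1) this, of w1 w5]
    local_moveI[OF assms(2,4), of "w1 @ [e, d] @ w2" "w4 @ [d, e] @ w5"]
  show ?thesis
    by (auto intro!: exI[of _ "w1 @ [e, d] @ w2 @ [f, g] @ w3 @ [g, f] @ w4 @ [d, e] @ w5"])
qed

lemma same_kind_two_moves:
  assumes nam: "naming \<Sigma> a b c"
    and x: "factor_at w i ([a, b] @ x @ [b, a])" and y: "factor_at w j ([a, b] @ y @ [b, a])"
    and "i < j" and dis: "pair_positions i x \<inter> pair_positions j y = {}"
    and w': "w' = swap_pairs (pair_starts i x \<union> pair_starts j y) w"
    and c: "c \<notin> set x" "c \<notin> set y"
  shows "\<exists>w''. local_move \<Sigma> c w w'' \<and> local_move \<Sigma> c w'' w'"
proof (rule two_factors_cases[OF x y \<open>i < j\<close> dis w'], goal_cases)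
  case (1 w1 w2 w3 w4 w5)
  then show ?case using two_moves_disjoint[OF nam nam] c by simp
next
  case (2 w1 w2 w3 w4 w5)
  then show ?case using two_moves_interleaved[OF nam nam, of w2 w3 w4] c by simp
next
  case (3 w1 w2 w3 w4 w5)
  then show ?case using two_moves_nested[OF nam nam, of w2 w3 w4] c by simp
qed

text \<open>In the interleaved case, the \<open>c\<close> in \<open>w3\<close> count for both factors and cancel. In the nested
  case, the outer factor has no \<open>c\<close> beyond those of the inner one. Its pairs can then be matched
  up with those of the inner factor instead.\<close>

lemma opposite_kind_cases:
  assumes nam: "naming \<Sigma> a b c"
    and x: "factor_at w i ([a, b] @ x @ [b, a])" and y: "factor_at w j ([b, a] @ y @ [a, b])"
    and "i < j" and dis: "pair_positions i x \<inter> pair_positions j y = {}"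
    and w': "w' = swap_pairs (pair_starts i x \<union> pair_starts j y) w"
    and c: "count_list x c = count_list y c"
  shows "(\<exists>w''. local_move \<Sigma> c w w'' \<and> local_move \<Sigma> c w'' w') \<or>
    (\<exists>w1 w2 w3 w4 w5. opposed_pairs a b c w w' w1 w2 w3 w4 w5 \<and> count_list w4 c > 0)"
proof -
  have c_simps: "a \<noteq> c" "b \<noteq> c" using nam by (auto simp: naming_def)
  note nam' = naming_swap[OF nam]
  have opposed: ?thesis if "opposed_pairs a b c w w' w1 w2 w3 w4 w5" for w1 w2 w3 w4 w5
  proof (cases "count_list w4 c > 0")
    case True
    with that show ?thesis by blast
  next
    case False
    with that have "c \<notin> set w2" "c \<notin> set w4"
      by (auto simp: opposed_pairs_def count_list_0_iff)
    with that two_moves_disjoint[OF nam nam'] show ?thesis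
      by (simp add: opposed_pairs_def)
  qed
  show ?thesis
  proof (rule two_factors_cases[OF x y \<open>i < j\<close> dis w'], goal_cases)
    case (1 w1 w2 w3 w4 w5)
    with c show ?case
      by (intro opposed[of w1 w2 w3 w4 w5]) (simp add: opposed_pairs_def)
  next
    case (2 w1 w2 w3 w4 w5)
    with c c_simps show ?case
      by (intro opposed[of w1 w2 w3 w4 w5]) (simp add: opposed_pairs_def)
  next
    case (3 w1 w2 w3 w4 w5)
    then have "c \<notin> set w2" "c \<notin> set w4"
      using c c_simps by (auto simp: count_list_0_iff)
    with 3 two_moves_disjoint[OF nam nam] show ?case by simp
  qed
qed

text \<open>For two factors of the same kind, both counts of \<open>c\<close> are on the same side of condition (3),
  and the other side is an empty sum. Hence both counts are \<open>0\<close>.\<close>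

lemma strong_transformation_2_cases:
  assumes "strong_transformation \<Sigma> 2 w w'"
  shows "(\<exists>w'' c. local_move \<Sigma> c w w'' \<and> local_move \<Sigma> c w'' w') \<or>
    (\<exists>a b c w1 w2 w3 w4 w5. naming \<Sigma> a b c \<and>
       opposed_pairs a b c w w' w1 w2 w3 w4 w5 \<and> count_list w4 c > 0)"
proof -
  obtain a b c t' p x where nam: "naming \<Sigma> a b c" and t': "t' \<le> (2::nat)"
    and f1: "\<forall>k\<in>{1..t'}. factor_at w (p k) ([a, b] @ x k @ [b, a])"
    and f2: "\<forall>k\<in>{t'+1..2}. factor_at w (p k) ([b, a] @ x k @ [a, b])"
    and dis: "\<forall>m\<in>{1..2}. \<forall>n\<in>{1..2}. m \<noteq> n \<longrightarrow>
      pair_positions (p m) (x m) \<inter> pair_positions (p n) (x n) = {}"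
    and sums: "(\<Sum>k\<in>{1..t'}. count_list (x k) c) = (\<Sum>k\<in>{t'+1..2}. count_list (x k) c)"
    and w': "w' = swap_pairs (\<Union>k\<in>{1..2}. pair_starts (p k) (x k)) w"
    using assms unfolding strong_transformation_def by blast
  note nam' = naming_swap[OF nam]
  have two: "{1..2} = {1, 2::nat}" by auto
  have d12: "pair_positions (p 1) (x 1) \<inter> pair_positions (p 2) (x 2) = {}"
    and d21: "pair_positions (p 2) (x 2) \<inter> pair_positions (p 1) (x 1) = {}"
    using dis two by auto
  have w12: "w' = swap_pairs (pair_starts (p 1) (x 1) \<union> pair_starts (p 2) (x 2)) w"
    using w' two by simp
  then have w21: "w' = swap_pairs (pair_starts (p 2) (x 2) \<union> pair_starts (p 1) (x 1)) w"
    by (simp add: Un_commute)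
  have ne: "p 1 \<noteq> p 2"
    using d12 by (auto simp: pair_positions_def pair_starts_def)
  have same: ?thesis
    if n: "naming \<Sigma> d e c" and f: "\<forall>k\<in>{1, 2}. factor_at w (p k) ([d, e] @ x k @ [e, d])"
      and "count_list (x 1) c + count_list (x 2) c = 0" for d e
  proof -
    have c: "c \<notin> set (x 1)" "c \<notin> set (x 2)"
      using that(3) by (simp_all add: count_list_0_iff)
    have f: "factor_at w (p 1) ([d, e] @ x 1 @ [e, d])" "factor_at w (p 2) ([d, e] @ x 2 @ [e, d])"
      using f by auto
    show ?thesis
      using ne same_kind_two_moves[OF n f _ d12 w12 c]
        same_kind_two_moves[OF n f(2,1) _ d21 w21 c(2,1)]
      by (meson linorder_neqE_nat)
  qed
  consider "t' = 0" | "t' = 1" | "t' = 2" using t' by linarith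
  then show ?thesis
  proof cases
    case 1
    then show ?thesis using f2 sums two by (intro same[OF nam']) (auto simp: numeral_2_eq_2)
  next
    case 2
    then have f: "factor_at w (p 1) ([a, b] @ x 1 @ [b, a])"
      "factor_at w (p 2) ([b, a] @ x 2 @ [a, b])"
      and c: "count_list (x 1) c = count_list (x 2) c"
      using f1 f2 sums by (auto simp: numeral_2_eq_2)
    \<comment> \<open>Exchanging the names \<open>a\<close> and \<open>b\<close> lets either factor play the role of the left one.\<close>
    show ?thesis
    proof (cases "p 1 < p 2")
      case True
      from opposite_kind_cases[OF nam f True d12 w12 c] nam show ?thesis by blast
    next
      case False
      with ne have "p 2 < p 1" by simp
      from opposite_kind_cases[OF nam' f(2,1) this d21 w21 c[symmetric]] nam' show ?thesis by blast
    qed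
  next
    case 3
    then show ?thesis using f1 sums two by (intro same[OF nam]) (auto simp: numeral_2_eq_2)
  qed
qed


section \<open>The stated form is irreducible\<close>

text \<open>Deleting the letter \<open>z\<close> gives the projection to the other two letters. If \<open>z\<close> is one of the
  letters \<open>d\<close>, \<open>e\<close> that are swapped, then in each swapped pair only the other one survives,
  so that both \<open>de\<close> and \<open>ed\<close> become the same letter.\<close>

lemma local_move_projection:
  assumes "local_move \<Sigma> c w w'" "z \<in> \<Sigma>"
  shows "filter (\<lambda>y. y \<noteq> z) w = filter (\<lambda>y. y \<noteq> z) w' \<longleftrightarrow> z \<noteq> c"
  using assms by (auto simp: local_move_def naming_def)

text \<open>The number of occurrences of \<open>ab\<close> as a scattered subword, usually written
  \<open>|w|\<^bsub>ab\<^esub>\<close>.\<close>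

primrec scattered_count :: "'a \<Rightarrow> 'a \<Rightarrow> 'a list \<Rightarrow> nat" where
  "scattered_count a b [] = 0"
| "scattered_count a b (y # ys) = (if y = a then count_list ys b else 0) + scattered_count a b ys"

lemma scattered_count_append:
  "scattered_count a b (u @ v) =
     scattered_count a b u + count_list u a * count_list v b + scattered_count a b v"
  by (induction u) (auto simp: algebra_simps)

lemma scattered_count_move:
  assumes "a \<noteq> b" "{d, e} = {a, b}"
  shows "scattered_count a b (u @ ([d, e] @ x @ [e, d]) @ v) =
    scattered_count a b (u @ ([e, d] @ x @ [d, e]) @ v)"
proof -
  have "d = a \<and> e = b \<or> d = b \<and> e = a" using assms(2) by (auto simp: doubleton_eq_iff)
  then show ?thesis
    using assms(1) by (auto simp: scattered_count_append algebra_simps)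
qed

text \<open>A prefix that ends just before a \<open>c\<close> cannot cut the \<open>c\<close>-free factor on which the move acts:
  it contains all of this factor or none of it.\<close>

lemma local_move_prefix:
  assumes "local_move \<Sigma> c w w'" "naming \<Sigma> a b c" "m < length w" "w ! m = c"
  shows "m < length w' \<and> w' ! m = c \<and>
    scattered_count a b (take m w') = scattered_count a b (take m w)"
proof -
  obtain d e u x v where nam: "naming \<Sigma> d e c" and x: "c \<notin> set x"
    and w: "w = u @ ([d, e] @ x @ [e, d]) @ v" and w': "w' = u @ ([e, d] @ x @ [d, e]) @ v"
    using assms(1) unfolding local_move_def by auto
  define F F' where "F = [d, e] @ x @ [e, d]" and "F' = [e, d] @ x @ [d, e]"
  have F: "length F' = length F" "c \<notin> set F"
    using nam x by (auto simp: F_def F'_def naming_def)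
  have ab: "a \<noteq> b" "{d, e} = {a, b}"
    using nam assms(2) by (auto simp: naming_def)
  show ?thesis
  proof (cases "m < length u")
    case True
    then show ?thesis using w w' assms(3,4) by (simp add: nth_append)
  next
    case False
    have "\<not> m - length u < length F"
    proof
      assume "m - length u < length F"
      then have "w ! m \<in> set F"
        using False unfolding w F_def[symmetric] by (simp add: nth_append)
      then show False using F assms(4) by simp
    qed
    then obtain k where "m = length u + (length F + k)"
      using False by (metis le_Suc_ex not_less add_diff_inverse_nat)
    then show ?thesis
      using assms(3,4) F scattered_count_move[OF ab, of u x "take k v", folded F_def F'_def]
      unfolding w w' F_def[symmetric] F'_def[symmetric]
      by (simp add: nth_append)
  qed
qed

lemma opposed_pairs_strong_transformation:
  assumes nam: "naming \<Sigma> a b c" and opp: "opposed_pairs a b c w w' w1 w2 w3 w4 w5"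
    and "w \<in> lists \<Sigma>"
  shows "strong_transformation \<Sigma> 2 w w'"
proof -
  have w: "w = w1 @ [a, b] @ w2 @ [b, a] @ w3 @ [b, a] @ w4 @ [a, b] @ w5"
    and w': "w' = w1 @ [b, a] @ w2 @ [a, b] @ w3 @ [a, b] @ w4 @ [b, a] @ w5"
    and c: "count_list w2 c = count_list w4 c"
    using opp by (auto simp: opposed_pairs_def)
  define i where "i = length w1"
  define j where "j = i + 2 + length w2 + 2 + length w3"
  have f1: "factor_at w i ([a, b] @ w2 @ [b, a])"
    unfolding factor_at_def w i_def by auto
  have f2: "factor_at w j ([b, a] @ w4 @ [a, b])"
    unfolding factor_at_def w j_def i_def
    by (intro exI[of _ "w1 @ [a, b] @ w2 @ [b, a] @ w3"] exI[of _ w5]) simp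
  have starts: "pair_starts i w2 \<union> pair_starts j w4 = {i, i + 2 + length w2, j, j + 2 + length w4}"
    by (auto simp: pair_starts_def)
  have sw: "w' = swap_pairs (pair_starts i w2 \<union> pair_starts j w4) w"
    unfolding starts w w' by (rule swap_four_pairs[symmetric]) (simp_all add: i_def j_def)
  have dis: "pair_positions i w2 \<inter> pair_positions j w4 = {}"
    by (auto simp: pair_positions_def pair_starts_def j_def)
  have two: "{Suc 0..2} = {1, 2::nat}" by auto
  have "w2 \<in> lists \<Sigma>" "w4 \<in> lists \<Sigma>" using assms(3) w by auto
  then show ?thesis
    unfolding strong_transformation_def
    using nam f1 f2 c dis sw
    by (intro conjI, simp) (rule exI[of _ a], rule exI[of _ b], rule exI[of _ c], rule exI[of _ 1],
        rule exI[of _ "\<lambda>k. if k = 1 then i else j"],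
        rule exI[of _ "\<lambda>k. if k = 1 then w2 else w4"], simp add: two Int_commute)
qed

lemma opposed_pairs_irreducible:
  assumes nam: "naming \<Sigma> a b c" and opp: "opposed_pairs a b c w w' w1 w2 w3 w4 w5"
    and pos: "count_list w4 c > 0"
    and moves: "local_move \<Sigma> c1 w w''" "local_move \<Sigma> c2 w'' w'"
  shows False
proof -
  let ?del = "\<lambda>z. filter (\<lambda>y. y \<noteq> z)"
  have w: "w = w1 @ [a, b] @ w2 @ [b, a] @ w3 @ [b, a] @ w4 @ [a, b] @ w5"
    and w': "w' = w1 @ [b, a] @ w2 @ [a, b] @ w3 @ [a, b] @ w4 @ [b, a] @ w5"
    and count: "count_list w2 c = count_list w4 c"
    using opp by (auto simp: opposed_pairs_def)
  have ab: "a \<noteq> b" "a \<noteq> c" "b \<noteq> c" and Sigma: "\<Sigma> = {a, b, c}"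
    using nam by (auto simp: naming_def)
  have proj: "?del z w = ?del z w' \<longleftrightarrow> z \<noteq> c" if "z \<in> \<Sigma>" for z
    using that ab unfolding Sigma w w' by auto
  have step1: "?del z w = ?del z w'' \<longleftrightarrow> z \<noteq> c1" if "z \<in> \<Sigma>" for z
    using local_move_projection[OF moves(1) that] .
  have step2: "?del z w'' = ?del z w' \<longleftrightarrow> z \<noteq> c2" if "z \<in> \<Sigma>" for z
    using local_move_projection[OF moves(2) that] .
  have in_Sigma: "c \<in> \<Sigma>" "c1 \<in> \<Sigma>" "c2 \<in> \<Sigma>"
    using moves Sigma by (auto simp: local_move_def naming_def)
  \<comment> \<open>Deleting \<open>c\<close> separates \<open>w\<close> from \<open>w'\<close>, so some move leaves \<open>c\<close> aside. If the other move
    left aside \<open>z \<noteq> c\<close>, it alone would change the projection that deletes \<open>z\<close>, which agrees on \<open>w\<close>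
    and \<open>w'\<close>.\<close>
  have "c1 = c" "c2 = c"
    using proj step1 step2 in_Sigma by metis+
  note moves' = moves[unfolded this]
  from pos count have "c \<in> set w2" by (metis count_list_0_iff less_irrefl)
  then obtain y z where w2: "w2 = y @ c # z" by (auto dest: split_list)
  define m where "m = length w1 + 2 + length y"
  have m: "m < length w" "w ! m = c" "take m w = w1 @ [a, b] @ y" "take m w' = w1 @ [b, a] @ y"
    unfolding m_def w w' w2 by (simp_all add: nth_append)
  have "scattered_count a b (w1 @ [b, a] @ y) = scattered_count a b (w1 @ [a, b] @ y)"
    using local_move_prefix[OF moves'(1) nam m(1,2)] local_move_prefix[OF moves'(2) nam] m(3,4)
    by metis
  then show False
    using ab by (simp add: scattered_count_append)
qed


section \<open>The characterisation\<close>

theorem theorem4p8: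
  fixes \<Sigma> :: "'a set" and w w' :: "'a list"
  assumes "card \<Sigma> = 3"
    and "w \<in> lists \<Sigma>" and "w' \<in> lists \<Sigma>"
  shows "irreducible_strong_transformation \<Sigma> 2 w w' \<longleftrightarrow>
    (\<exists>a b c. naming \<Sigma> a b c \<and>
      (\<exists>w1\<in>lists \<Sigma>. \<exists>w2\<in>lists \<Sigma>. \<exists>w3\<in>lists \<Sigma>. \<exists>w4\<in>lists \<Sigma>. \<exists>w5\<in>lists \<Sigma>.
        w = w1 @ [a, b] @ w2 @ [b, a] @ w3 @ [b, a] @ w4 @ [a, b] @ w5 \<and>
        w' = w1 @ [b, a] @ w2 @ [a, b] @ w3 @ [a, b] @ w4 @ [b, a] @ w5 \<and>
        count_list w2 c = count_list w4 c \<and> count_list w4 c > 0))"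
    (is "_ \<longleftrightarrow> ?form")
proof
  assume "irreducible_strong_transformation \<Sigma> 2 w w'"
  then have "strong_transformation \<Sigma> 2 w w'" and irred: "\<not> reducible_transformation \<Sigma> 2 w w'"
    by (auto simp: irreducible_strong_transformation_def)
  with strong_transformation_2_cases[OF this(1)] obtain a b c w1 w2 w3 w4 w5
    where form: "naming \<Sigma> a b c" "opposed_pairs a b c w w' w1 w2 w3 w4 w5" "count_list w4 c > 0"
    using reducible_2_iff[OF assms(2)] by blast
  then have "w1 \<in> lists \<Sigma>" "w2 \<in> lists \<Sigma>" "w3 \<in> lists \<Sigma>" "w4 \<in> lists \<Sigma>" "w5 \<in> lists \<Sigma>"
    using assms(2) by (auto simp: opposed_pairs_def)
  with form show ?form unfolding opposed_pairs_def by blast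
next
  assume ?form
  then obtain a b c w1 w2 w3 w4 w5
    where form: "naming \<Sigma> a b c" "opposed_pairs a b c w w' w1 w2 w3 w4 w5" "count_list w4 c > 0"
    unfolding opposed_pairs_def by blast
  then show "irreducible_strong_transformation \<Sigma> 2 w w'"
    using opposed_pairs_strong_transformation[OF form(1,2) assms(2)]
      opposed_pairs_irreducible[OF form] reducible_2_iff[OF assms(2)]
    unfolding irreducible_strong_transformation_def by blast
qed

end
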